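(* Let assumptions (A1)--(A5) listed in the context hold, assume $I_{\mathrm{int}}$ is nonempty, and let $J\Subset I_{\mathrm{int}}$ be a compact interval. Suppose that $m$ is Lipschitz continuous and that the control partitions $\Pi_n$ resolve the endpoints of $J$ (i.e. the endpoints of $J$ are grid points). Then $$H_J(u^{(n),*})=H_J(u^* )+O(|\Pi_n|^2).$$ If, in addition, $u^*$ is globally Lipschitz on $I_{\mathrm{ctrl}}$, then the same rate holds for the full objective: $$H(u^{(n),*})=H(u^* )+O(|\Pi_n|^2).$$
   Context: Let $(\Omega,\mathcal F,\mathbb P)$ be a probability space, $0<\lambda_{\min}<\lambda_{\max}$, and $T>0$. Assumptions: (A1) $\lambda:\Omega\to\mathbb R$ is a random variable with $\lambda_{\min}\le\lambda\le\lambda_{\max}$ almost surely. (A2) The cumulative distribution function $F_\lambda$ of $\lambda$ belongs to $C^1([\lambda_{\min},\lambda_{\max}])$, and $\lambda$ has density $\phi_\lambda$. (A3) $D:[0,T]\times\Omega\to[0,\infty)$ is jointly measurable and $D\in L^2(\Omega\times(0,T))$. (A4) $m(t):=\mathbb E[D(t)]$. (A5) $\lambda$ is independent of the process $D$, i.e. $\sigma(\lambda)$ and $\sigma(D(t):t\in[0,T])$ are independent. Notation: $I_{\mathrm{ctrl}}:=[0,T-1/\lambda_{\max}]$, $I_{\mathrm{int}}:=\left[\frac1{\lambda_{\min}}-\frac1{\lambda_{\max}},T-\frac1{\lambda_{\min}}\right]$, $$H(u):=\int_{1/\lambda_{\min}}^{T}\mathbb E\left[\left(u\left(s-\frac1\lambda\right)-D(s)\right)^2\right]\mathrm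 ds,\qquad H_J(u):=\int_J\mathbb E\left[\left(u(t)-D\left(t+\frac1\lambda\right)\right)^2\right]\mathrm dt.$$ For $t\in I_{\mathrm{ctrl}}$, $\Lambda(t):=\{\ell\in[\lambda_{\min},\lambda_{\max}]:1/\lambda_{\min}\le t+1/\ell\le T\}$, $q(t):=\int_{\Lambda(t)}\phi_\lambda(\ell)\,\mathrm d\ell$. The continuous-time optimal control is, where $q(t)>0$, $$u^*(t):=\frac1{q(t)}\int_{\Lambda(t)}m\left(t+\frac1\ell\right)\phi_\lambda(\ell)\,\mathrm d\ell ;$$ its values where $q(t)=0$ do not affect the objective. $\Pi_n=\{0=t_0<\dots<t_{n+1}=T-1/\lambda_{\max}\}$ are partitions of $I_{\mathrm{ctrl}}$ with mesh size $|\Pi_n|=\max_i(t_{i+1}-t_i)$. The optimal piecewise constant control $u^{(n),*}$ (the minimizer of $H$ among functions constant on each cell $[t_i,t_{i+1})$) takes, on each cell with $\int_{t_i}^{t_{i+1}}q\,\mathrm dt>0$, the value $$u_i^{(n),*}=\frac{\int_{t_i}^{t_{i+1}}q(t)u^*(t)\,\mathrm dt}{\int_{t_i}^{t_{i+1}}q(t)\,\mathrm dt};$$ its values on the other cells do not affect $H$. The $O$-terms are as $|\Pi_n|\to0$ with everything else fixed. $J\Subset I_{\mathrm{int}}$ means $J$ is compactly contained in $I_{\mathrm{int}}$. *)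

theory Defs
  imports "HOL-Probability.Probability" "HOL-Library.Landau_Symbols"
begin

text \<open>Continuous differentiability on a closed interval, with one-sided derivatives at the
  endpoints (the library's \<open>C1_differentiable_on\<close> would ask for two-sided ones).\<close>

definition C1_on :: "real set \<Rightarrow> (real \<Rightarrow> real) \<Rightarrow> bool" where
  "C1_on S f \<longleftrightarrow>
     (\<exists>f'. continuous_on S f' \<and> (\<forall>x\<in>S. (f has_real_derivative f' x) (at x within S)))"

definition compactly_contained :: "'a::topological_space set \<Rightarrow> 'a set \<Rightarrow> bool" where
  "compactly_contained J X \<longleftrightarrow> compact (closure J) \<and> closure J \<subseteq> interior X"

text \<open>Controls live on \<open>[0, T - 1/lmax]\<close> and the process \<open>D\<close> on \<open>[0, T]\<close>. Both are extended by
  zero where they are evaluated at a random time. Such a time leaves the domain only on the null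
  event that \<open>lam\<close> lies outside \<open>[lmin, lmax]\<close>; the extension keeps the integrand measurable
  there.\<close>

definition zero_ext :: "real set \<Rightarrow> (real \<Rightarrow> real) \<Rightarrow> real \<Rightarrow> real" where
  "zero_ext A f x = (if x \<in> A then f x else 0)"

definition I_ctrl :: "real \<Rightarrow> real \<Rightarrow> real set" where
  "I_ctrl T lmax = {0 .. T - 1 / lmax}"

definition I_int :: "real \<Rightarrow> real \<Rightarrow> real \<Rightarrow> real set" where
  "I_int T lmin lmax = {1 / lmin - 1 / lmax .. T - 1 / lmin}"

definition H_full ::
  "'a measure \<Rightarrow> real \<Rightarrow> real \<Rightarrow> real \<Rightarrow> ('a \<Rightarrow> real) \<Rightarrow> (real \<Rightarrow> 'a \<Rightarrow> real) \<Rightarrow> (real \<Rightarrow> real) \<Rightarrow> real"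
where
  "H_full M T lmin lmax lam D u =
     (LINT s:{1 / lmin .. T}|lborel.
        (LINT \<omega>|M. (zero_ext (I_ctrl T lmax) u (s - 1 / lam \<omega>) - D s \<omega>)\<^sup>2))"

definition H_on ::
  "'a measure \<Rightarrow> real \<Rightarrow> ('a \<Rightarrow> real) \<Rightarrow> (real \<Rightarrow> 'a \<Rightarrow> real) \<Rightarrow> real set \<Rightarrow> (real \<Rightarrow> real) \<Rightarrow> real"
where
  "H_on M T lam D J u =
     (LINT t:J|lborel.
        (LINT \<omega>|M. (u t - zero_ext {0..T} (\<lambda>r. D r \<omega>) (t + 1 / lam \<omega>))\<^sup>2))"

definition mean_fun :: "'a measure \<Rightarrow> (real \<Rightarrow> 'a \<Rightarrow> real) \<Rightarrow> real \<Rightarrow> real" where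
  "mean_fun M D t = (LINT \<omega>|M. D t \<omega>)"

definition Lam :: "real \<Rightarrow> real \<Rightarrow> real \<Rightarrow> real \<Rightarrow> real set" where
  "Lam T lmin lmax t = {l \<in> {lmin..lmax}. 1 / lmin \<le> t + 1 / l \<and> t + 1 / l \<le> T}"

definition q_weight :: "real \<Rightarrow> real \<Rightarrow> real \<Rightarrow> (real \<Rightarrow> real) \<Rightarrow> real \<Rightarrow> real" where
  "q_weight T lmin lmax \<phi> t = (LINT l:Lam T lmin lmax t|lborel. \<phi> l)"

text \<open>The continuous-time optimal control is determined only where \<open>q > 0\<close>. The predicate admits
  every measurable version, so that Lipschitz continuity on all of \<open>I_ctrl\<close> can be asked of a
  version; a fixed default value at the zeros of \<open>q\<close> (e.g. at \<open>t = 0\<close>) could make it fail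
  spuriously.\<close>

definition optimal_control ::
  "'a measure \<Rightarrow> real \<Rightarrow> real \<Rightarrow> real \<Rightarrow> (real \<Rightarrow> real) \<Rightarrow> (real \<Rightarrow> 'a \<Rightarrow> real) \<Rightarrow> (real \<Rightarrow> real) \<Rightarrow> bool"
where
  "optimal_control M T lmin lmax \<phi> D u \<longleftrightarrow>
     set_borel_measurable borel (I_ctrl T lmax) u \<and>
     (\<forall>t\<in>I_ctrl T lmax. q_weight T lmin lmax \<phi> t > 0 \<longrightarrow>
        u t = 1 / q_weight T lmin lmax \<phi> t *
              (LINT l:Lam T lmin lmax t|lborel. mean_fun M D (t + 1 / l) * \<phi> l))"

definition ctrl_partition :: "real \<Rightarrow> real \<Rightarrow> nat \<Rightarrow> (nat \<Rightarrow> real) \<Rightarrow> bool" where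
  "ctrl_partition T lmax n t \<longleftrightarrow>
     t 0 = 0 \<and> t (n + 1) = T - 1 / lmax \<and> (\<forall>i\<le>n. t i < t (i + 1))"

definition mesh :: "nat \<Rightarrow> (nat \<Rightarrow> real) \<Rightarrow> real" where
  "mesh n t = Max ((\<lambda>i. t (i + 1) - t i) ` {..n})"

definition piecewise_const :: "nat \<Rightarrow> (nat \<Rightarrow> real) \<Rightarrow> (real \<Rightarrow> real) \<Rightarrow> bool" where
  "piecewise_const n t u \<longleftrightarrow> (\<forall>i\<le>n. \<exists>c. \<forall>x\<in>{t i ..< t (i + 1)}. u x = c)"

text \<open>Optimality is minimality of \<open>H_full\<close> among the functions constant on each cell. It fixes the
  value on a cell to the \<open>q\<close>-weighted average of the continuous-time optimal control wherever
  the cell has positive \<open>q\<close>-mass, and leaves the other cells free.\<close>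

definition optimal_pc_control ::
  "'a measure \<Rightarrow> real \<Rightarrow> real \<Rightarrow> real \<Rightarrow> ('a \<Rightarrow> real) \<Rightarrow> (real \<Rightarrow> 'a \<Rightarrow> real) \<Rightarrow>
   nat \<Rightarrow> (nat \<Rightarrow> real) \<Rightarrow> (real \<Rightarrow> real) \<Rightarrow> bool"
where
  "optimal_pc_control M T lmin lmax lam D n t u \<longleftrightarrow>
     is_arg_min (H_full M T lmin lmax lam D) (piecewise_const n t) u"

definition process_events :: "'a measure \<Rightarrow> real \<Rightarrow> (real \<Rightarrow> 'a \<Rightarrow> real) \<Rightarrow> 'a set set" where
  "process_events M T D =
     sigma_sets (space M) (\<Union>t\<in>{0..T}. {D t -` B \<inter> space M | B. B \<in> sets borel})"

end

theory Submission imports Defs begin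

text \<open>Substituting \<open>s = t + 1 / \<lambda>\<close> for each fixed \<open>\<omega>\<close> turns both objectives into the integral of
  the same squared error over a region \<open>A\<close> of emission times (\<open>A = I_ctrl\<close> for the full objective,
  \<open>A = J\<close> for the restricted one). After the substitution \<open>D\<close> is evaluated at deterministic times, so
  independence of \<open>\<lambda>\<close> and each single \<open>D(s)\<close> suffices, and completing the square gives
  \<open>objective A u - objective A u\<^sup>* = \<integral>\<^sub>A q (u - u\<^sup>*)\<^sup>2\<close>. Since the grid resolves \<open>A\<close>, an optimal piecewise
  constant control \<open>u\<close> may be compared with the control that agrees with \<open>u\<close> off \<open>A\<close> and takes the
  left endpoint values of \<open>u\<^sup>*\<close> on \<open>A\<close>; optimality bounds the gap of \<open>u\<close> over \<open>A\<close> by that of the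
  interpolant, which is at most \<open>L\<^sup>2 |A| mesh\<^sup>2\<close>.\<close>

section \<open>Shifts and restrictions on products with Lebesgue measure\<close>

text \<open>For fixed \<open>x\<close> the map translates \<open>t\<close> by the constant
  \<open>h x\<close>, which preserves \<open>lborel\<close>; Tonelli with the
  \<open>t\<close>-integral inside carries this over to the product. This is what allows a random
  delay to be substituted away.\<close>

lemma distr_pair_lborel_shift:
  assumes "sigma_finite_measure N" and [measurable]: "h \<in> borel_measurable N"
  shows "distr (lborel \<Otimes>\<^sub>M N) (lborel \<Otimes>\<^sub>M N) (\<lambda>(t, x). (t + h x :: real, x)) = lborel \<Otimes>\<^sub>M N"
proof (rule measure_eqI)
  interpret N: sigma_finite_measure N by fact
  interpret pair_sigma_finite lborel N ..
  fix X assume "X \<in> sets (distr (lborel \<Otimes>\<^sub>M N) (lborel \<Otimes>\<^sub>M N) (\<lambda>(t, x). (t + h x, x)))"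
  then have X[measurable]: "X \<in> sets (lborel \<Otimes>\<^sub>M N)" by simp
  have [measurable]: "(\<lambda>z. indicator X z :: ennreal) \<in> borel_measurable (lborel \<Otimes>\<^sub>M N)"
    by (rule borel_measurable_indicator) (rule X)
  have "emeasure (distr (lborel \<Otimes>\<^sub>M N) (lborel \<Otimes>\<^sub>M N) (\<lambda>(t, x). (t + h x, x))) X
      = (\<integral>\<^sup>+z. indicator X z \<partial>distr (lborel \<Otimes>\<^sub>M N) (lborel \<Otimes>\<^sub>M N) (\<lambda>(t, x). (t + h x, x)))"
    using X by (subst nn_integral_indicator) simp_all
  also have "\<dots> = (\<integral>\<^sup>+z. indicator X (case z of (t, x) \<Rightarrow> (t + h x, x)) \<partial>(lborel \<Otimes>\<^sub>M N))"
    by (rule nn_integral_distr) simp_all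
  also have "\<dots> = (\<integral>\<^sup>+x. \<integral>\<^sup>+t. indicator X (t + h x, x) \<partial>lborel \<partial>N)"
    by (subst nn_integral_snd[symmetric]) (auto intro!: nn_integral_cong)
  also have "\<dots> = (\<integral>\<^sup>+x. \<integral>\<^sup>+t. indicator X (t, x) \<partial>lborel \<partial>N)"
  proof (rule nn_integral_cong)
    fix x assume [measurable]: "x \<in> space N"
    have "(\<lambda>t. (t, x)) \<in> borel \<rightarrow>\<^sub>M (lborel \<Otimes>\<^sub>M N)" by simp
    then have "(\<lambda>t. indicator X (t, x) :: ennreal) \<in> borel_measurable borel"
      by (rule measurable_compose) measurable
    from nn_integral_real_affine[OF this, of 1 "h x"]
    show "(\<integral>\<^sup>+t. indicator X (t + h x, x) \<partial>lborel) = (\<integral>\<^sup>+t. indicator X (t, x) \<partial>lborel)"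
      by (simp add: add.commute)
  qed
  also have "\<dots> = emeasure (lborel \<Otimes>\<^sub>M N) X"
    by (subst nn_integral_snd) (simp, simp add: nn_integral_indicator[OF X])
  finally show "emeasure (distr (lborel \<Otimes>\<^sub>M N) (lborel \<Otimes>\<^sub>M N) (\<lambda>(t, x). (t + h x, x))) X
    = emeasure (lborel \<Otimes>\<^sub>M N) X" .
qed simp

lemma zero_ext_eq_indicator: "zero_ext A f x = indicator A x * f x"
  by (simp add: zero_ext_def indicator_def)

text \<open>The process is jointly measurable only over its time domain. Extension by zero is
  multiplication by the indicator of \<open>A \<times> space N\<close>, which turns measurability on
  the restricted space into measurability on the full product.\<close>

lemma borel_measurable_pair_zero_ext:
  assumes "A \<in> sets borel"
    and f: "(\<lambda>(t, x). f t x) \<in> borel_measurable (restrict_space borel A \<Otimes>\<^sub>M N)"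
  shows "(\<lambda>(t, x). zero_ext A (\<lambda>r. f r x) t) \<in> borel_measurable (lborel \<Otimes>\<^sub>M N)"
proof -
  let ?R = "restrict_space (lborel \<Otimes>\<^sub>M N) (A \<times> space N)"
  have "fst \<in> ?R \<rightarrow>\<^sub>M restrict_space borel A"
    by (intro measurable_restrict_space2 measurable_restrict_space1)
       (auto simp: space_restrict_space)
  moreover have "snd \<in> ?R \<rightarrow>\<^sub>M N"
    by (intro measurable_restrict_space1) simp
  ultimately have "(\<lambda>z. (fst z, snd z)) \<in> ?R \<rightarrow>\<^sub>M restrict_space borel A \<Otimes>\<^sub>M N"
    by (rule measurable_Pair)
  from measurable_compose[OF this f]
  have "(\<lambda>(t, x). f t x) \<in> borel_measurable ?R" by (simp add: case_prod_beta)
  moreover have "A \<times> space N \<inter> space (lborel \<Otimes>\<^sub>M N) \<in> sets (lborel \<Otimes>\<^sub>M N)"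
    using assms(1) by (intro sets.Int pair_measureI sets.top) auto
  ultimately have "(\<lambda>z. indicator (A \<times> space N) z *\<^sub>R (case z of (t, x) \<Rightarrow> f t x))
      \<in> borel_measurable (lborel \<Otimes>\<^sub>M N)"
    by (subst (asm) borel_measurable_restrict_space_iff)
  moreover have "(case z of (t, x) \<Rightarrow> zero_ext A (\<lambda>r. f r x) t)
      = indicator (A \<times> space N) z *\<^sub>R (case z of (t, x) \<Rightarrow> f t x)"
    if "z \<in> space (lborel \<Otimes>\<^sub>M N)" for z
    using that by (auto simp: space_pair_measure zero_ext_def indicator_def split: if_splits)
  ultimately show ?thesis by (subst measurable_cong) auto
qed

text \<open>Serves to move the square integrability of the process from the restricted product to
  the full one, where the random shift acts.\<close>

lemma nn_integral_restrict_space_pair: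
  fixes f :: "real \<times> 'a \<Rightarrow> ennreal"
  assumes N: "sigma_finite_measure N" and A: "A \<in> sets borel"
    and f: "f \<in> borel_measurable (lborel \<Otimes>\<^sub>M N)"
  shows "(\<integral>\<^sup>+z. f z \<partial>(restrict_space lborel A \<Otimes>\<^sub>M N))
       = (\<integral>\<^sup>+z. f z * indicator A (fst z) \<partial>(lborel \<Otimes>\<^sub>M N))"
proof -
  interpret N: sigma_finite_measure N by fact
  note f[measurable] A[measurable]
  have "(\<lambda>z. (fst z, snd z)) \<in> restrict_space lborel A \<Otimes>\<^sub>M N \<rightarrow>\<^sub>M lborel \<Otimes>\<^sub>M N"
    by (intro measurable_Pair measurable_compose[OF measurable_fst] measurable_snd
        measurable_restrict_space1) simp
  then have fR: "f \<in> borel_measurable (restrict_space lborel A \<Otimes>\<^sub>M N)"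
    using measurable_compose[OF _ f] by simp
  have "(\<integral>\<^sup>+z. f z \<partial>(restrict_space lborel A \<Otimes>\<^sub>M N))
      = (\<integral>\<^sup>+t. \<integral>\<^sup>+x. f (t, x) \<partial>N \<partial>restrict_space lborel A)"
    by (rule N.nn_integral_fst[OF fR, symmetric])
  also have "\<dots> = (\<integral>\<^sup>+t. \<integral>\<^sup>+x. f (t, x) * indicator A t \<partial>N \<partial>lborel)"
    using A by (subst nn_integral_restrict_space) (auto simp: nn_integral_multc intro!: nn_integral_cong)
  also have "\<dots> = (\<integral>\<^sup>+z. f z * indicator A (fst z) \<partial>(lborel \<Otimes>\<^sub>M N))"
    by (subst N.nn_integral_fst[symmetric]) simp_all
  finally show ?thesis .
qed

subsection \<open>Piecewise constant functions on a partition\<close>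

text \<open>Induction over the cells: each new cell adds a constant times an indicator and enlarges
  the bound by that constant. The conjunct \<open>t 0 \<le> t k\<close> is carried along so that the
  longer prefix splits into the old one and the new cell.\<close>

lemma piecewise_const_prefix:
  assumes pc: "piecewise_const n t u" and p: "ctrl_partition T lmax n t" and k: "k \<le> n + 1"
  shows "(\<lambda>x. indicator {t 0..<t k} x * u x) \<in> borel_measurable borel
    \<and> (\<exists>B. \<forall>x\<in>{t 0..<t k}. \<bar>u x\<bar> \<le> B) \<and> t 0 \<le> t k"
  using k
proof (induction k)
  case (Suc k)
  then have k: "k \<le> n" by simp
  obtain B where IH: "(\<lambda>x. indicator {t 0..<t k} x * u x) \<in> borel_measurable borel"
      "\<forall>x\<in>{t 0..<t k}. \<bar>u x\<bar> \<le> B" "t 0 \<le> t k"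
    using Suc by auto
  note IH(1)[measurable]
  obtain c where c: "\<forall>x\<in>{t k..<t (k + 1)}. u x = c"
    using pc k by (auto simp: piecewise_const_def)
  have lt: "t k < t (k + 1)" using p k by (simp add: ctrl_partition_def)
  have "(\<lambda>x. indicator {t 0..<t (Suc k)} x * u x)
      = (\<lambda>x. indicator {t 0..<t k} x * u x + indicator {t k..<t (k + 1)} x * c)"
    using c IH(3) lt by (auto simp: fun_eq_iff indicator_def)
  moreover have "(\<lambda>x. indicator {t 0..<t k} x * u x + indicator {t k..<t (k + 1)} x * c)
      \<in> borel_measurable borel"
    by measurable
  moreover have "\<forall>x\<in>{t 0..<t (Suc k)}. \<bar>u x\<bar> \<le> max B \<bar>c\<bar>"
    using IH(2) c by (metis Suc_eq_plus1 atLeastLessThan_iff le_max_iff_disj linorder_not_le order_refl)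
  ultimately show ?case using IH(3) lt by auto
qed simp

lemma ctrl_partition_mono:
  assumes "ctrl_partition T lmax n t" "i \<le> j" "j \<le> n + 1"
  shows "t i \<le> t j"
  using assms(2,3)
proof (induction j rule: dec_induct)
  case (step m)
  then have "t m < t (m + 1)" using assms(1) by (simp add: ctrl_partition_def)
  then show ?case using step by simp
qed simp

lemma ctrl_partition_cell:
  assumes p: "ctrl_partition T lmax n t" and x: "0 \<le> x" "x < T - 1 / lmax"
  obtains i where "i \<le> n" "t i \<le> x" "x < t (i + 1)"
proof -
  \<comment> \<open>Minimality makes the previous cell end at or before \<open>x\<close>, which
    yields \<open>t i \<le> x\<close>.\<close>
  define i where "i = (LEAST i. x < t (i + 1))"
  have n: "x < t (n + 1)" using p x by (simp add: ctrl_partition_def)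
  have i: "x < t (i + 1)" unfolding i_def by (rule LeastI[of "\<lambda>i. x < t (i + 1)", OF n])
  have "i \<le> n" unfolding i_def by (rule Least_le[of "\<lambda>i. x < t (i + 1)", OF n])
  moreover have "t i \<le> x"
  proof (cases i)
    case 0 then show ?thesis using p x by (simp add: ctrl_partition_def)
  next
    case (Suc j)
    then have "j < i" by simp
    then have "\<not> x < t (j + 1)" unfolding i_def by (rule not_less_Least)
    then show ?thesis using Suc by simp
  qed
  ultimately show ?thesis using i that by blast
qed

lemma ctrl_partition_cell_unique:
  assumes p: "ctrl_partition T lmax n t" and "i \<le> n" "j \<le> n"
    and "t i \<le> x" "x < t (i + 1)" "t j \<le> x" "x < t (j + 1)"
  shows "i = j"
proof (rule linorder_cases[of i j])
  assume "i < j"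
  then have "t (i + 1) \<le> t j" using ctrl_partition_mono[OF p, of "i + 1" j] assms by simp
  then show ?thesis using assms by linarith
next
  assume "j < i"
  then have "t (j + 1) \<le> t i" using ctrl_partition_mono[OF p, of "j + 1" i] assms by simp
  then show ?thesis using assms by linarith
qed

text \<open>Monotonicity of the grid settles the position of \<open>a\<close> by comparing its index
  with \<open>i\<close>. In this form the resolution of an endpoint enters: no cell straddles
  it.\<close>

lemma ctrl_partition_cell_side:
  assumes p: "ctrl_partition T lmax n t" and "i \<le> n" and "a \<in> t ` {..n + 1}"
  shows "a \<le> t i \<or> t (i + 1) \<le> a"
proof -
  obtain j where j: "j \<le> n + 1" "a = t j" using assms by auto
  show ?thesis
  proof (cases "j \<le> i")
    case True
    then show ?thesis using ctrl_partition_mono[OF p True] assms j by simp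
  next
    case False
    then show ?thesis using ctrl_partition_mono[OF p, of "i + 1" j] j by simp
  qed
qed

lemma mesh_ge: "i \<le> n \<Longrightarrow> t (i + 1) - t i \<le> mesh n t"
  unfolding mesh_def by (rule Max_ge) auto

text \<open>Builds the competitor against which an optimal \<open>u\<close> is tested: on each cell
  inside the interval it is the value of \<open>f\<close> at the left endpoint. The interval is
  half-open because the cells are; at \<open>b\<close> itself \<open>y\<close> keeps the value of
  \<open>u\<close>.\<close>

lemma piecewise_const_interpolant:
  assumes p: "ctrl_partition T lmax n t" and u: "piecewise_const n t u"
    and ab: "a \<in> t ` {..n + 1}" "b \<in> t ` {..n + 1}" and lip: "L-lipschitz_on {a..b} f"
  obtains y where "piecewise_const n t y" "\<And>x. x \<notin> {a..<b} \<Longrightarrow> y x = u x"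
    "\<And>x. x \<in> {a..<b} \<Longrightarrow> \<bar>y x - f x\<bar> \<le> L * mesh n t"
proof -
  define cell where "cell x = (THE i. i \<le> n \<and> t i \<le> x \<and> x < t (i + 1))" for x
  have cell: "cell x = i" if "i \<le> n" "t i \<le> x" "x < t (i + 1)" for x i
    unfolding cell_def by (rule the_equality) (use that ctrl_partition_cell_unique[OF p] in blast)+
  define y where "y x = (if x \<in> {a..<b} then f (t (cell x)) else u x)" for x
  have "piecewise_const n t y"
    unfolding piecewise_const_def
  proof (intro allI impI)
    fix i assume i: "i \<le> n"
    obtain c where c: "\<forall>x\<in>{t i..<t (i + 1)}. u x = c"
      using u i by (auto simp: piecewise_const_def)
    have "{t i..<t (i + 1)} \<subseteq> {a..<b} \<or> {t i..<t (i + 1)} \<inter> {a..<b} = {}"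
      using ctrl_partition_cell_side[OF p i ab(1)] ctrl_partition_cell_side[OF p i ab(2)] by auto
    then show "\<exists>c. \<forall>x\<in>{t i..<t (i + 1)}. y x = c"
    proof
      assume "{t i..<t (i + 1)} \<subseteq> {a..<b}"
      then have "\<forall>x\<in>{t i..<t (i + 1)}. y x = f (t i)" using cell[OF i] by (auto simp: y_def)
      then show ?thesis by blast
    next
      assume "{t i..<t (i + 1)} \<inter> {a..<b} = {}"
      then have "\<forall>x\<in>{t i..<t (i + 1)}. y x = c" using c unfolding y_def by auto
      then show ?thesis by blast
    qed
  qed
  moreover have "\<bar>y x - f x\<bar> \<le> L * mesh n t" if x: "x \<in> {a..<b}" for x
  proof -
    have t0: "t 0 \<le> a" "b \<le> t (n + 1)"
      using ab ctrl_partition_mono[OF p] by auto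
    then have "0 \<le> x" "x < T - 1 / lmax" using p x by (auto simp: ctrl_partition_def)
    then obtain i where i: "i \<le> n" "t i \<le> x" "x < t (i + 1)" by (rule ctrl_partition_cell[OF p])
    \<comment> \<open>The left endpoint has to stay in \<open>{a..b}\<close>, where the Lipschitz
      bound for \<open>f\<close> is available.\<close>
    have "a \<le> t i" using ctrl_partition_cell_side[OF p i(1) ab(1)] i x by auto
    then have "dist (f (t i)) (f x) \<le> L * dist (t i) x"
      using i x by (intro lipschitz_onD[OF lip]) auto
    also have "\<dots> \<le> L * mesh n t"
      using lipschitz_on_nonneg[OF lip] mesh_ge[OF i(1), of t] i
      by (intro mult_left_mono) (auto simp: dist_real_def)
    finally show ?thesis using x cell[OF i] by (simp add: y_def dist_real_def)
  qed
  ultimately show ?thesis by (intro that[of y]) (auto simp: y_def)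
qed

subsection \<open>Random delays\<close>

text \<open>The condition \<open>horizon\<close> is a consequence of \<open>I_int\<close> being
  nonempty; it says that the window of arrival times \<open>{1 / lmin..T}\<close> is
  nonempty.\<close>

locale delayed_control = prob_space M for M :: "'a measure" +
  fixes T lmin lmax :: real and lam :: "'a \<Rightarrow> real" and \<phi> :: "real \<Rightarrow> real"
    and D :: "real \<Rightarrow> 'a \<Rightarrow> real"
  assumes lmin_pos: "0 < lmin" and lmin_less_lmax: "lmin < lmax" and horizon: "1 / lmin \<le> T"
    and lam_measurable[measurable]: "lam \<in> borel_measurable M"
    and lam_bounds: "AE \<omega> in M. lmin \<le> lam \<omega> \<and> lam \<omega> \<le> lmax"
    and density_nonneg: "\<And>x. 0 \<le> \<phi> x"
    and lam_distributed: "distributed M lborel lam (\<lambda>x. ennreal (\<phi> x))"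
    and D_measurable: "(\<lambda>(t, \<omega>). D t \<omega>) \<in> borel_measurable (restrict_space borel {0..T} \<Otimes>\<^sub>M M)"
    and D_square_integrable:
      "integrable (restrict_space lborel {0<..<T} \<Otimes>\<^sub>M M) (\<lambda>(t, \<omega>). (D t \<omega>)\<^sup>2)"
    and indep: "indep_set (sets (vimage_algebra (space M) lam borel)) (process_events M T D)"
    and mean_lipschitz: "\<exists>L. L-lipschitz_on {0..T} (mean_fun M D)"
begin

sublocale LM: pair_sigma_finite lborel M ..

lemma recip_lmax: "0 < 1 / lmax" "1 / lmax < 1 / lmin"
  using lmin_pos lmin_less_lmax by (auto simp: field_simps)

lemma AE_recip_lam: "AE \<omega> in M. 1 / lmax \<le> 1 / lam \<omega> \<and> 1 / lam \<omega> \<le> 1 / lmin"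
  using lam_bounds
proof eventually_elim
  case (elim \<omega>)
  then show ?case using lmin_pos by (auto intro!: divide_left_mono mult_pos_pos)
qed

text \<open>The window of arrival times over which \<open>H_full\<close> integrates.\<close>

definition S :: "real set" where "S = {1 / lmin..T}"

lemma S_measurable[measurable]: "S \<in> sets borel" by (simp add: S_def)

lemma S_subset: "S \<subseteq> {0..T}"
  using lmin_pos by (auto simp: S_def intro: order_trans[of 0 "1 / lmin"])

text \<open>The process as a function on the whole product space, so that it can be composed with
  random shifts that leave \<open>{0..T}\<close>.\<close>

definition demand :: "real \<times> 'a \<Rightarrow> real" where
  "demand z = zero_ext {0..T} (\<lambda>r. D r (snd z)) (fst z)"

lemma demand_measurable[measurable]: "demand \<in> borel_measurable (lborel \<Otimes>\<^sub>M M)"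
  using borel_measurable_pair_zero_ext[OF _ D_measurable]
  by (simp add: demand_def[abs_def] case_prod_beta)

lemma demand_eq: "t \<in> {0..T} \<Longrightarrow> demand (t, \<omega>) = D t \<omega>"
  by (simp add: demand_def zero_ext_def)

text \<open>The hypothesis integrates over \<open>{0<..<T}\<close>, whereas \<open>demand\<close>
  lives on \<open>{0..T}\<close>; the two endpoints contribute a null set of the product.\<close>

lemma demand_square_integrable: "integrable (lborel \<Otimes>\<^sub>M M) (\<lambda>z. (demand z)\<^sup>2)"
proof (rule integrableI_bounded)
  have "(\<integral>\<^sup>+z. ennreal (norm ((demand z)\<^sup>2)) \<partial>(lborel \<Otimes>\<^sub>M M))
      = (\<integral>\<^sup>+z. ennreal ((demand z)\<^sup>2) * indicator {0<..<T} (fst z) \<partial>(lborel \<Otimes>\<^sub>M M))"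
  proof (rule nn_integral_cong_AE)
    have "AE z in lborel \<Otimes>\<^sub>M M. fst z \<noteq> 0 \<and> fst z \<noteq> T"
    proof (rule LM.AE_pair_measure)
      have "AE t in lborel. t \<noteq> 0 \<and> t \<noteq> T"
        using AE_lborel_singleton[of 0] AE_lborel_singleton[of T] by eventually_elim simp
      then show "AE t in lborel. AE \<omega> in M. fst (t, \<omega>) \<noteq> 0 \<and> fst (t, \<omega>) \<noteq> T"
        by eventually_elim simp
    qed measurable
    then show "AE z in lborel \<Otimes>\<^sub>M M. ennreal (norm ((demand z)\<^sup>2))
        = ennreal ((demand z)\<^sup>2) * indicator {0<..<T} (fst z)"
      by eventually_elim (auto simp: demand_def zero_ext_def indicator_def)
  qed
  also have "\<dots> = (\<integral>\<^sup>+z. ennreal ((demand z)\<^sup>2) \<partial>(restrict_space lborel {0<..<T} \<Otimes>\<^sub>M M))"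
    by (subst nn_integral_restrict_space_pair) (simp_all, unfold_locales)
  also have "\<dots> = (\<integral>\<^sup>+z. ennreal (norm (case z of (t, \<omega>) \<Rightarrow> (D t \<omega>)\<^sup>2))
      \<partial>(restrict_space lborel {0<..<T} \<Otimes>\<^sub>M M))"
    by (rule nn_integral_cong)
       (auto simp: space_pair_measure space_restrict_space demand_eq)
  also have "\<dots> < \<infinity>"
    using D_square_integrable by (simp add: integrable_iff_bounded)
  finally show "(\<integral>\<^sup>+z. ennreal (norm ((demand z)\<^sup>2)) \<partial>(lborel \<Otimes>\<^sub>M M)) < \<infinity>" .
qed measurable

text \<open>The events of a single \<open>D t\<close> form a sub-sigma-algebra of
  \<open>process_events\<close>, and independence passes to it. Measurability of \<open>D t\<close>
  comes from \<open>process_events\<close> consisting of events.\<close>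

lemma indep_lam_D:
  assumes "t \<in> {0..T}"
  shows "indep_var borel lam borel (D t)"
proof -
  have ev: "process_events M T D \<subseteq> events"
    using indep by (rule indep_setD_ev2)
  have sub: "D t -` B \<inter> space M \<in> process_events M T D" if "B \<in> sets borel" for B
    unfolding process_events_def using assms that by (intro sigma_sets.Basic) blast
  have D_rv: "random_variable borel (D t)"
    using ev sub by (intro measurableI) auto
  have "sigma_sets (space M) {D t -` B \<inter> space M | B. B \<in> sets borel} \<subseteq> process_events M T D"
    unfolding process_events_def using assms by (intro sigma_sets_mono') blast
  then have "indep_set (sigma_sets (space M) {lam -` A \<inter> space M | A. A \<in> sets borel})
      (sigma_sets (space M) {D t -` A \<inter> space M | A. A \<in> sets borel})"
    using indep unfolding indep_sets2_eq sets_vimage_algebra by blast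
  then show ?thesis
    unfolding indep_var_eq using D_rv by simp
qed

text \<open>At a deterministic arrival time the control factor depends on \<open>lam\<close> alone,
  so the expectation of the product factorizes.\<close>

lemma expectation_lam_D:
  assumes t: "t \<in> {0..T}" and [measurable]: "V \<in> borel_measurable borel"
    and bnd: "\<And>x. \<bar>V x\<bar> \<le> B" and int: "integrable M (D t)"
  shows "(LINT \<omega>|M. V (t - 1 / lam \<omega>) * D t \<omega>) = (LINT \<omega>|M. V (t - 1 / lam \<omega>)) * mean_fun M D t"
proof -
  have "indep_var borel ((\<lambda>x. V (t - 1 / x)) \<circ> lam) borel ((\<lambda>x. x) \<circ> D t)"
    by (rule indep_var_compose[OF indep_lam_D[OF t]]) measurable
  then have "indep_var borel (\<lambda>\<omega>. V (t - 1 / lam \<omega>)) borel (D t)" by (simp add: comp_def)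
  moreover have "integrable M (\<lambda>\<omega>. V (t - 1 / lam \<omega>))"
    by (rule integrable_const_bound[of _ B]) (use bnd in auto)
  ultimately show ?thesis
    using int unfolding mean_fun_def by (rule indep_var_lebesgue_integral)
qed

lemma bounded_integrable_pair:
  fixes f :: "real \<times> 'a \<Rightarrow> real"
  assumes "f \<in> borel_measurable (lborel \<Otimes>\<^sub>M M)"
    and "\<And>z. \<bar>f z\<bar> \<le> B" and "\<And>z. fst z \<notin> S \<Longrightarrow> f z = 0"
  shows "integrable (lborel \<Otimes>\<^sub>M M) f"
proof (rule integrableI_bounded_set[where A = "S \<times> space M" and B = B])
  show "S \<times> space M \<in> sets (lborel \<Otimes>\<^sub>M M)"
    by (intro pair_measureI) auto
  have "emeasure (lborel \<Otimes>\<^sub>M M) (S \<times> space M) = emeasure lborel S * emeasure M (space M)"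
    by (rule emeasure_pair_measure_Times) auto
  also have "\<dots> < \<infinity>"
    using horizon by (simp add: S_def emeasure_space_1)
  finally show "emeasure (lborel \<Otimes>\<^sub>M M) (S \<times> space M) < \<infinity>" .
  show "AE z in lborel \<Otimes>\<^sub>M M. z \<notin> S \<times> space M \<longrightarrow> f z = 0"
    using assms(3) by (intro AE_I2) (force simp: space_pair_measure)
qed (use assms in auto)

section \<open>Change of variables between emission and arrival times\<close>

lemma shift_measurable[measurable]:
  "(\<lambda>(t, \<omega>). (t + 1 / lam \<omega>, \<omega>)) \<in> lborel \<Otimes>\<^sub>M M \<rightarrow>\<^sub>M lborel \<Otimes>\<^sub>M M"
  by simp

lemma distr_shift:
  "distr (lborel \<Otimes>\<^sub>M M) (lborel \<Otimes>\<^sub>M M) (\<lambda>(t, \<omega>). (t + 1 / lam \<omega>, \<omega>)) = lborel \<Otimes>\<^sub>M M"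
  by (rule distr_pair_lborel_shift) (unfold_locales, simp)

lemma
  fixes f :: "real \<times> 'a \<Rightarrow> real"
  assumes f: "integrable (lborel \<Otimes>\<^sub>M M) f"
  shows integrable_shift: "integrable (lborel \<Otimes>\<^sub>M M) (\<lambda>(t, \<omega>). f (t + 1 / lam \<omega>, \<omega>))"
    and integral_shift:
      "(LINT t|lborel. LINT \<omega>|M. f (t + 1 / lam \<omega>, \<omega>)) = (LINT t|lborel. LINT \<omega>|M. f (t, \<omega>))"
proof -
  have f': "f \<in> borel_measurable (lborel \<Otimes>\<^sub>M M)" using f by simp
  show int: "integrable (lborel \<Otimes>\<^sub>M M) (\<lambda>(t, \<omega>). f (t + 1 / lam \<omega>, \<omega>))"
    using integrable_distr[OF shift_measurable, of f, unfolded distr_shift] f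
    by (simp add: case_prod_beta')
  have "(LINT t|lborel. LINT \<omega>|M. f (t + 1 / lam \<omega>, \<omega>))
      = (LINT z|(lborel \<Otimes>\<^sub>M M). (case z of (t, \<omega>) \<Rightarrow> f (t + 1 / lam \<omega>, \<omega>)))"
    using LM.integral_fst'[OF int] by simp
  also have "\<dots> = (LINT z|(lborel \<Otimes>\<^sub>M M). f z)"
    using integral_distr[OF shift_measurable f', unfolded distr_shift] by (simp add: case_prod_beta')
  finally show "(LINT t|lborel. LINT \<omega>|M. f (t + 1 / lam \<omega>, \<omega>)) = (LINT t|lborel. LINT \<omega>|M. f (t, \<omega>))"
    using LM.integral_fst'[OF f] by simp
qed

text \<open>Moves the delay from \<open>V\<close> to \<open>W\<close>: the integrand is bounded and
  vanishes off \<open>S\<close>, hence integrable; after the shift \<open>V t\<close> is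
  deterministic and leaves the expectation.\<close>

lemma
  fixes W V :: "real \<Rightarrow> real"
  assumes [measurable]: "W \<in> borel_measurable borel" "V \<in> borel_measurable borel"
    and W: "\<And>x. \<bar>W x\<bar> \<le> B" and V: "\<And>x. \<bar>V x\<bar> \<le> C" and W0: "\<And>x. x \<notin> S \<Longrightarrow> W x = 0"
  shows integral_delay_swap: "(LINT s|lborel. LINT \<omega>|M. W s * V (s - 1 / lam \<omega>))
      = (LINT t|lborel. V t * (LINT \<omega>|M. W (t + 1 / lam \<omega>)))"
    and integrable_delay_swap: "integrable lborel (\<lambda>t. V t * (LINT \<omega>|M. W (t + 1 / lam \<omega>)))"
proof -
  let ?f = "\<lambda>z. W (fst z) * V (fst z - 1 / lam (snd z))"
  have f: "integrable (lborel \<Otimes>\<^sub>M M) ?f"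
  proof (rule bounded_integrable_pair[where B = "B * C"])
    have "0 \<le> B" using W[of 0] by linarith
    then show "\<bar>?f z\<bar> \<le> B * C" for z
      unfolding abs_mult by (intro mult_mono W V) auto
  qed (simp_all add: W0)
  show "(LINT s|lborel. LINT \<omega>|M. W s * V (s - 1 / lam \<omega>))
      = (LINT t|lborel. V t * (LINT \<omega>|M. W (t + 1 / lam \<omega>)))"
    using integral_shift[OF f] by (simp add: mult.commute[of _ "V _"])
  show "integrable lborel (\<lambda>t. V t * (LINT \<omega>|M. W (t + 1 / lam \<omega>)))"
    using LM.integrable_fst'[OF integrable_shift[OF f]] by (simp add: mult.commute[of _ "V _"])
qed

text \<open>The cutoff to \<open>S\<close> takes over the role of the constraint
  \<open>l \<in> Lam T lmin lmax t\<close> in the integrals defining the optimal control.\<close>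

definition wmean :: "real \<Rightarrow> real" where "wmean = zero_ext S (mean_fun M D)"

lemma wmean_off: "x \<notin> S \<Longrightarrow> wmean x = 0"
  by (simp add: wmean_def zero_ext_def)

lemma wmean_measurable[measurable]: "wmean \<in> borel_measurable borel"
proof -
  obtain L where "L-lipschitz_on {0..T} (mean_fun M D)" using mean_lipschitz by blast
  then have "continuous_on {0..T} (mean_fun M D)" by (rule lipschitz_on_continuous_on)
  then have "continuous_on S (mean_fun M D)" using S_subset by (rule continuous_on_subset)
  then have "(\<lambda>x. indicator S x *\<^sub>R mean_fun M D x) \<in> borel_measurable borel"
    by (intro borel_measurable_continuous_on_indicator) auto
  then show ?thesis by (simp add: wmean_def zero_ext_eq_indicator[abs_def])
qed

lemma wmean_bounded: "\<exists>B. \<forall>x. \<bar>wmean x\<bar> \<le> B"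
proof -
  obtain L where "L-lipschitz_on {0..T} (mean_fun M D)" using mean_lipschitz by blast
  then have "continuous_on {0..T} (mean_fun M D)" by (rule lipschitz_on_continuous_on)
  then have "bounded (mean_fun M D ` {0..T})"
    by (intro compact_imp_bounded compact_continuous_image) auto
  then obtain B where B: "\<forall>x\<in>{0..T}. \<bar>mean_fun M D x\<bar> \<le> B"
    by (auto simp: bounded_iff)
  have "\<bar>wmean x\<bar> \<le> max B 0" for x
    using B S_subset by (force simp: wmean_def zero_ext_def)
  then show ?thesis by blast
qed

text \<open>\<open>q t\<close> is the probability that an emission at time \<open>t\<close> arrives
  in the window. Together with \<open>g\<close>, the numerator of the optimal control, it is written
  as an expectation; \<open>q_eq_q_weight\<close> and \<open>g_eq_mean\<close> recover the density
  integrals.\<close>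

definition q :: "real \<Rightarrow> real" where "q t = (LINT \<omega>|M. indicator S (t + 1 / lam \<omega>))"

definition g :: "real \<Rightarrow> real" where "g t = (LINT \<omega>|M. wmean (t + 1 / lam \<omega>))"

lemma q_bounds: "0 \<le> q t" "q t \<le> 1"
proof -
  show "0 \<le> q t" unfolding q_def by (rule integral_nonneg_AE) simp
  have "q t \<le> (LINT \<omega>|M. 1)"
    unfolding q_def by (rule integral_mono) (auto intro!: integrable_const_bound[where B = 1] simp: indicator_def)
  then show "q t \<le> 1" by (simp add: prob_space)
qed

section \<open>Expansion of the squared error\<close>

definition admissible :: "real set \<Rightarrow> (real \<Rightarrow> real) \<Rightarrow> bool" where
  "admissible A u \<longleftrightarrow> (\<lambda>x. indicator A x * u x) \<in> borel_measurable borel \<and> (\<exists>B. \<forall>x\<in>A. \<bar>u x\<bar> \<le> B)"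

text \<open>The first coordinate is the arrival time, which keeps \<open>demand\<close> at a
  deterministic time; the set \<open>A\<close> restricts the random emission time.\<close>

definition loss :: "real set \<Rightarrow> (real \<Rightarrow> real) \<Rightarrow> real \<times> 'a \<Rightarrow> real" where
  "loss A u z = indicator S (fst z) * indicator A (fst z - 1 / lam (snd z)) *
     (u (fst z - 1 / lam (snd z)) - demand z)\<^sup>2"

text \<open>The part of the expanded square that does not involve the control; it cancels whenever
  two controls are compared on the same \<open>A\<close>.\<close>

definition demand_energy :: "real set \<Rightarrow> real" where
  "demand_energy A = (LINT s|lborel. LINT \<omega>|M.
     indicator S s * indicator A (s - 1 / lam \<omega>) * (demand (s, \<omega>))\<^sup>2)"

text \<open>Independence replaces \<open>D s\<close> by its mean, and
  \<open>integral_delay_swap\<close> then moves the delay from \<open>V\<close> to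
  \<open>wmean\<close>. The first step holds for almost every \<open>s\<close>, as integrability of
  \<open>D s\<close> is obtained from Fubini.\<close>

lemma demand_cross_term:
  fixes V :: "real \<Rightarrow> real"
  assumes [measurable]: "V \<in> borel_measurable borel" and V: "\<And>x. \<bar>V x\<bar> \<le> B"
  defines "f \<equiv> \<lambda>z. indicator S (fst z) * V (fst z - 1 / lam (snd z)) * demand z"
  shows "integrable (lborel \<Otimes>\<^sub>M M) f"
    and "(LINT s|lborel. LINT \<omega>|M. f (s, \<omega>)) = (LINT t|lborel. V t * g t)"
    and "integrable lborel (\<lambda>t. V t * g t)"
proof -
  have B: "0 \<le> B" using V[of 0] by linarith
  have dom: "integrable (lborel \<Otimes>\<^sub>M M) (\<lambda>z. indicator S (fst z) + (demand z)\<^sup>2 :: real)"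
    by (intro Bochner_Integration.integrable_add demand_square_integrable
        bounded_integrable_pair[where B = 1]) (auto simp: indicator_def)
  \<comment> \<open>From \<open>(\<bar>demand z\<bar> - 1)^2 \<ge> 0\<close>; since \<open>S\<close>
    has finite length, square integrability thus gives integrability over \<open>S\<close>.\<close>
  have le: "\<bar>indicator S (fst z) * demand z\<bar> \<le> indicator S (fst z) + (demand z)\<^sup>2" for z
  proof -
    have "2 * \<bar>demand z\<bar> \<le> 1 + (demand z)\<^sup>2"
      using sum_squares_ge_zero[of "\<bar>demand z\<bar> - 1" 0] by (simp add: power2_eq_square algebra_simps)
    then have "\<bar>demand z\<bar> \<le> 1 + (demand z)\<^sup>2"
      using abs_ge_zero[of "demand z"] by linarith
    then show ?thesis by (simp add: indicator_def)
  qed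
  have D1: "integrable (lborel \<Otimes>\<^sub>M M) (\<lambda>z. indicator S (fst z) * demand z)"
    by (rule Bochner_Integration.integrable_bound[OF dom])
       (use le in \<open>auto simp: order_trans[OF _ abs_ge_self]\<close>)
  show f: "integrable (lborel \<Otimes>\<^sub>M M) f"
  proof (rule Bochner_Integration.integrable_bound[OF integrable_mult_right[OF D1, of B]])
    show "f \<in> borel_measurable (lborel \<Otimes>\<^sub>M M)" unfolding f_def by measurable
    have "\<bar>f z\<bar> = \<bar>V (fst z - 1 / lam (snd z))\<bar> * \<bar>indicator S (fst z) * demand z\<bar>" for z
      by (simp add: f_def abs_mult)
    also have "\<dots> z \<le> B * \<bar>indicator S (fst z) * demand z\<bar>" for z
      by (intro mult_right_mono V) simp
    finally show "AE z in lborel \<Otimes>\<^sub>M M. norm (f z) \<le> norm (B * (indicator S (fst z) * demand z))"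
      using B by (simp add: abs_mult)
  qed
  obtain K where K: "\<And>x. \<bar>wmean x\<bar> \<le> K" using wmean_bounded by blast
  have "AE s in lborel. (LINT \<omega>|M. f (s, \<omega>)) = (LINT \<omega>|M. wmean s * V (s - 1 / lam \<omega>))"
    using LM.AE_integrable_fst'[OF D1]
  proof eventually_elim
    case (elim s)
    show ?case
    proof (cases "s \<in> S")
      case True
      then have s: "s \<in> {0..T}" using S_subset by blast
      with elim True have "integrable M (D s)" by (simp add: demand_eq)
      from expectation_lam_D[OF s assms(1) V this] show ?thesis
        using True s by (simp add: f_def demand_eq wmean_def zero_ext_def mult.commute)
    qed (simp add: f_def wmean_off)
  qed
  then have "(LINT s|lborel. LINT \<omega>|M. f (s, \<omega>))
      = (LINT s|lborel. LINT \<omega>|M. wmean s * V (s - 1 / lam \<omega>))"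
    by (intro integral_cong_AE borel_measurable_integrable[OF LM.integrable_fst'[OF f]]) measurable
  also have "\<dots> = (LINT t|lborel. V t * g t)"
    unfolding g_def by (rule integral_delay_swap[OF _ _ K V wmean_off]) measurable
  finally show "(LINT s|lborel. LINT \<omega>|M. f (s, \<omega>)) = (LINT t|lborel. V t * g t)" .
  show "integrable lborel (\<lambda>t. V t * g t)"
    unfolding g_def by (rule integrable_delay_swap[OF _ _ K V wmean_off]) measurable
qed

lemma
  assumes u: "admissible A u" and [measurable]: "A \<in> sets borel"
  shows loss_integrable: "integrable (lborel \<Otimes>\<^sub>M M) (loss A u)"
    and loss_eq: "(LINT s|lborel. LINT \<omega>|M. loss A u (s, \<omega>))
      = demand_energy A + (LINT t|lborel. indicator A t * (q t * (u t)\<^sup>2 - 2 * g t * u t))"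
    and loss_density_integrable: "integrable lborel (\<lambda>t. indicator A t * (q t * (u t)\<^sup>2 - 2 * g t * u t))"
proof -
  \<comment> \<open>Indicators are idempotent, so cutting \<open>u\<close> off outside
    \<open>A\<close> absorbs the factor \<open>indicator A\<close> in both the square and the cross
    term, and makes the control bounded and measurable everywhere.\<close>
  define v where "v x = indicator A x * u x" for x
  have v_meas[measurable]: "v \<in> borel_measurable borel" using u by (simp add: admissible_def v_def[abs_def])
  obtain B where B: "\<And>x. \<bar>v x\<bar> \<le> B"
  proof -
    obtain B where "\<forall>x\<in>A. \<bar>u x\<bar> \<le> B" using u by (auto simp: admissible_def)
    then have "\<bar>v x\<bar> \<le> max B 0" for x by (force simp: v_def indicator_def)
    then show ?thesis by (rule that)
  qed
  have B2: "\<bar>(v x)\<^sup>2\<bar> \<le> B\<^sup>2" for x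
    using power_mono[OF B[of x], of 2] by simp
  let ?f1 = "\<lambda>z. indicator S (fst z) * (v (fst z - 1 / lam (snd z)))\<^sup>2 :: real"
  let ?f2 = "\<lambda>z. indicator S (fst z) * v (fst z - 1 / lam (snd z)) * demand z"
  let ?f3 = "\<lambda>z. indicator S (fst z) * indicator A (fst z - 1 / lam (snd z)) * (demand z)\<^sup>2 :: real"
  have dec: "loss A u z = ?f1 z - 2 * ?f2 z + ?f3 z" for z
    by (auto simp: loss_def v_def indicator_def power2_eq_square algebra_simps)
  have dens: "indicator A t * (q t * (u t)\<^sup>2 - 2 * g t * u t) = (v t)\<^sup>2 * q t - 2 * (v t * g t)" for t
    by (auto simp: v_def indicator_def)
  have i1: "integrable (lborel \<Otimes>\<^sub>M M) ?f1"
    by (rule bounded_integrable_pair[where B = "B\<^sup>2"]) (use B2 in \<open>auto simp: indicator_def\<close>)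
  have i2: "integrable (lborel \<Otimes>\<^sub>M M) ?f2"
    by (rule demand_cross_term(1)[OF v_meas B])
  have i3: "integrable (lborel \<Otimes>\<^sub>M M) ?f3"
    by (rule Bochner_Integration.integrable_bound[OF demand_square_integrable]) (auto simp: indicator_def)
  show *: "integrable (lborel \<Otimes>\<^sub>M M) (loss A u)"
    unfolding dec[abs_def] using i1 i2 i3
    by (intro Bochner_Integration.integrable_add Bochner_Integration.integrable_diff
        integrable_mult_right)
  have S1: "\<bar>indicator S x :: real\<bar> \<le> 1" for x by (simp add: indicator_def)
  have e1: "(LINT s|lborel. LINT \<omega>|M. ?f1 (s, \<omega>)) = (LINT t|lborel. (v t)\<^sup>2 * q t)"
    unfolding q_def fst_conv snd_conv by (rule integral_delay_swap[OF _ _ S1 B2]) auto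
  have i1': "integrable lborel (\<lambda>t. (v t)\<^sup>2 * q t)"
    unfolding q_def by (rule integrable_delay_swap[OF _ _ S1 B2]) auto
  note e2 = demand_cross_term(2)[OF v_meas B] and i2' = demand_cross_term(3)[OF v_meas B]
  show "integrable lborel (\<lambda>t. indicator A t * (q t * (u t)\<^sup>2 - 2 * g t * u t))"
    unfolding dens using i1' i2' by (intro Bochner_Integration.integrable_diff integrable_mult_right)
  have "(LINT s|lborel. LINT \<omega>|M. loss A u (s, \<omega>)) = (LINT z|(lborel \<Otimes>\<^sub>M M). loss A u z)"
    by (rule LM.integral_fst'[OF *])
  also have "\<dots> = (LINT z|(lborel \<Otimes>\<^sub>M M). ?f1 z) - 2 * (LINT z|(lborel \<Otimes>\<^sub>M M). ?f2 z)
      + (LINT z|(lborel \<Otimes>\<^sub>M M). ?f3 z)"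
    unfolding dec using i1 i2 i3 by simp
  also have "\<dots> = (LINT t|lborel. (v t)\<^sup>2 * q t) - 2 * (LINT t|lborel. v t * g t) + demand_energy A"
    using e1 e2 LM.integral_fst'[OF i1] LM.integral_fst'[OF i2] LM.integral_fst'[OF i3]
    by (simp add: demand_energy_def)
  also have "\<dots> = demand_energy A + (LINT t|lborel. indicator A t * (q t * (u t)\<^sup>2 - 2 * g t * u t))"
    unfolding dens using i1' i2' by simp
  finally show "(LINT s|lborel. LINT \<omega>|M. loss A u (s, \<omega>))
      = demand_energy A + (LINT t|lborel. indicator A t * (q t * (u t)\<^sup>2 - 2 * g t * u t))" .
qed

subsection \<open>The objectives as weighted square distances\<close>

abbreviation "I \<equiv> I_ctrl T lmax"

lemma I_measurable[measurable]: "I \<in> sets borel" by (simp add: I_ctrl_def)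

definition objective :: "real set \<Rightarrow> (real \<Rightarrow> real) \<Rightarrow> real" where
  "objective A u = (LINT s|lborel. LINT \<omega>|M. loss A u (s, \<omega>))"

lemma loss_section_measurable:
  assumes "admissible A u" "A \<in> sets borel"
  shows "(\<lambda>\<omega>. loss A u (s, \<omega>)) \<in> borel_measurable M"
  using measurable_compose[OF _ borel_measurable_integrable[OF loss_integrable[OF assms]],
      of "\<lambda>\<omega>. (s, \<omega>)" M] by simp

text \<open>For an arrival time in \<open>S\<close>, a delay between \<open>1 / lmax\<close> and
  \<open>1 / lmin\<close> puts the emission time in \<open>I\<close>, so \<open>indicator I\<close>
  in \<open>loss\<close> is almost surely 1.\<close>

lemma H_full_eq_objective:
  assumes u: "admissible I u"
  shows "H_full M T lmin lmax lam D u = objective I u"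
  unfolding H_full_def objective_def set_lebesgue_integral_def
proof (intro Bochner_Integration.integral_cong refl)
  fix s :: real
  have [measurable]: "(\<lambda>x. zero_ext I u x) \<in> borel_measurable borel"
    using u by (simp add: admissible_def zero_ext_eq_indicator[abs_def])
  show "indicator {1 / lmin..T} s *\<^sub>R (LINT \<omega>|M. (zero_ext I u (s - 1 / lam \<omega>) - D s \<omega>)\<^sup>2)
      = (LINT \<omega>|M. loss I u (s, \<omega>))"
  proof (cases "s \<in> S")
    case True
    then have s: "s \<in> {0..T}" using S_subset by blast
    have "(LINT \<omega>|M. (zero_ext I u (s - 1 / lam \<omega>) - D s \<omega>)\<^sup>2) = (LINT \<omega>|M. loss I u (s, \<omega>))"
    proof (rule integral_cong_AE)
      have [measurable]: "D s \<in> borel_measurable M"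
        using indep_lam_D[OF s] by (simp add: indep_var_eq)
      show "(\<lambda>\<omega>. (zero_ext I u (s - 1 / lam \<omega>) - D s \<omega>)\<^sup>2) \<in> borel_measurable M"
        by measurable
      show "AE \<omega> in M. (zero_ext I u (s - 1 / lam \<omega>) - D s \<omega>)\<^sup>2 = loss I u (s, \<omega>)"
        using AE_recip_lam
      proof eventually_elim
        case (elim \<omega>)
        then have "s - 1 / lam \<omega> \<in> I" using True by (auto simp: I_ctrl_def S_def)
        then show ?case using True s by (simp add: loss_def demand_eq zero_ext_def)
      qed
    qed (rule loss_section_measurable[OF u I_measurable])
    then show ?thesis using True by (simp add: S_def)
  next
    case False
    then show ?thesis by (simp add: loss_def S_def)
  qed
qed

text \<open>The two bounds of \<open>I_int\<close> are what the shortest and the longest delay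
  require for arrival inside the window.\<close>

lemma shift_in_S:
  assumes "t \<in> I_int T lmin lmax"
  shows "AE \<omega> in M. t + 1 / lam \<omega> \<in> S"
  using AE_recip_lam
proof eventually_elim
  case (elim \<omega>)
  then show ?case using assms by (auto simp: S_def I_int_def)
qed

text \<open>\<open>H_on\<close> is already written in emission time. On \<open>I_int\<close> every
  delay arrives in \<open>S\<close> almost surely, so \<open>indicator S\<close> costs nothing, and
  \<open>integral_shift\<close> passes to arrival time.\<close>

lemma H_on_eq_objective:
  assumes u: "admissible A u" and A[measurable]: "A \<in> sets borel" and sub: "A \<subseteq> I_int T lmin lmax"
  shows "H_on M T lam D A u = objective A u"
proof -
  have "H_on M T lam D A u = (LINT t|lborel. LINT \<omega>|M. loss A u (t + 1 / lam \<omega>, \<omega>))"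
    unfolding H_on_def set_lebesgue_integral_def
  proof (intro Bochner_Integration.integral_cong refl)
    fix t :: real
    show "indicator A t *\<^sub>R (LINT \<omega>|M. (u t - zero_ext {0..T} (\<lambda>r. D r \<omega>) (t + 1 / lam \<omega>))\<^sup>2)
        = (LINT \<omega>|M. loss A u (t + 1 / lam \<omega>, \<omega>))"
    proof (cases "t \<in> A")
      case True
      have "(LINT \<omega>|M. (u t - demand (t + 1 / lam \<omega>, \<omega>))\<^sup>2)
          = (LINT \<omega>|M. loss A u (t + 1 / lam \<omega>, \<omega>))"
      proof (rule integral_cong_AE)
        have "(\<lambda>\<omega>. (t + 1 / lam \<omega>, \<omega>)) \<in> M \<rightarrow>\<^sub>M lborel \<Otimes>\<^sub>M M" by simp
        from measurable_compose[OF this borel_measurable_integrable[OF loss_integrable[OF u A]]]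
        show "(\<lambda>\<omega>. loss A u (t + 1 / lam \<omega>, \<omega>)) \<in> borel_measurable M" .
        have "AE \<omega> in M. t + 1 / lam \<omega> \<in> S" using True sub by (intro shift_in_S) blast
        then show "AE \<omega> in M. (u t - demand (t + 1 / lam \<omega>, \<omega>))\<^sup>2 = loss A u (t + 1 / lam \<omega>, \<omega>)"
          by eventually_elim (simp add: loss_def True)
      qed measurable
      then show ?thesis using True by (simp add: demand_def)
    next
      case False
      then show ?thesis by (simp add: loss_def)
    qed
  qed
  also have "\<dots> = objective A u"
    unfolding objective_def by (rule integral_shift[OF loss_integrable[OF u A]])
  finally show ?thesis .
qed

lemma objective_eq:
  assumes "admissible A u" "A \<in> sets borel"
  shows "objective A u = demand_energy A + (LINT t|lborel. indicator A t * (q t * (u t)\<^sup>2 - 2 * g t * u t))"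
  unfolding objective_def by (rule loss_eq[OF assms])

section \<open>The weight and the optimal control in terms of the density\<close>

lemma AE_density_zero: "AE l in lborel. l \<notin> {lmin..lmax} \<longrightarrow> \<phi> l = 0"
proof -
  have "AE l in distr M lborel lam. l \<in> {lmin..lmax}"
    using lam_bounds by (subst AE_distr_iff) auto
  then have "AE l in density lborel (\<lambda>x. ennreal (\<phi> x)). l \<in> {lmin..lmax}"
    unfolding distributed_distr_eq_density[OF lam_distributed] .
  then have "AE l in lborel. ennreal (\<phi> l) > 0 \<longrightarrow> l \<in> {lmin..lmax}"
    using distributed_borel_measurable[OF lam_distributed] by (subst (asm) AE_density) auto
  then show ?thesis
    by eventually_elim (use density_nonneg in \<open>auto simp: order.order_iff_strict\<close>)
qed

lemma expectation_eq_density: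
  fixes h :: "real \<Rightarrow> real"
  assumes [measurable]: "h \<in> borel_measurable borel"
    and off: "\<And>l. l \<in> {lmin..lmax} \<Longrightarrow> l \<notin> Lam T lmin lmax t \<Longrightarrow> h l = 0"
  shows "(LINT \<omega>|M. h (lam \<omega>)) = (LINT l:Lam T lmin lmax t|lborel. h l * \<phi> l)"
proof -
  have [measurable]: "\<phi> \<in> borel_measurable borel"
    using distributed_real_measurable[OF density_nonneg lam_distributed] by simp
  have [measurable]: "Lam T lmin lmax t \<in> sets borel"
    unfolding Lam_def by measurable
  have "(LINT \<omega>|M. h (lam \<omega>)) = (LINT l|lborel. \<phi> l * h l)"
    by (rule distributed_integral[OF lam_distributed, symmetric]) (simp_all add: density_nonneg)
  also have "\<dots> = (LINT l:Lam T lmin lmax t|lborel. h l * \<phi> l)"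
    unfolding set_lebesgue_integral_def
  proof (rule integral_cong_AE)
    show "AE l in lborel. \<phi> l * h l = indicator (Lam T lmin lmax t) l *\<^sub>R (h l * \<phi> l)"
      using AE_density_zero by eventually_elim (use off in \<open>auto simp: indicator_def\<close>)
  qed measurable
  finally show ?thesis .
qed

lemma in_Lam_iff: "l \<in> {lmin..lmax} \<Longrightarrow> l \<in> Lam T lmin lmax t \<longleftrightarrow> t + 1 / l \<in> S"
  by (auto simp: Lam_def S_def)

lemma Lam_S: "l \<in> Lam T lmin lmax t \<Longrightarrow> t + 1 / l \<in> S"
  by (auto simp: Lam_def S_def)

lemma q_eq_q_weight: "q t = q_weight T lmin lmax \<phi> t"
proof -
  have "q t = (LINT l:Lam T lmin lmax t|lborel. indicator S (t + 1 / l) * \<phi> l)"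
    unfolding q_def by (rule expectation_eq_density) (auto simp: in_Lam_iff)
  also have "\<dots> = q_weight T lmin lmax \<phi> t"
    unfolding q_weight_def set_lebesgue_integral_def
    by (rule Bochner_Integration.integral_cong) (auto simp: indicator_def dest: Lam_S)
  finally show ?thesis .
qed

lemma g_eq_mean: "g t = (LINT l:Lam T lmin lmax t|lborel. mean_fun M D (t + 1 / l) * \<phi> l)"
proof -
  have "g t = (LINT l:Lam T lmin lmax t|lborel. wmean (t + 1 / l) * \<phi> l)"
    unfolding g_def by (rule expectation_eq_density) (auto simp: in_Lam_iff wmean_off)
  also have "\<dots> = (LINT l:Lam T lmin lmax t|lborel. mean_fun M D (t + 1 / l) * \<phi> l)"
    unfolding set_lebesgue_integral_def
    by (rule Bochner_Integration.integral_cong) (auto simp: indicator_def wmean_def zero_ext_def dest: Lam_S)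
  finally show ?thesis .
qed

text \<open>\<open>wmean\<close> vanishes off \<open>S\<close>, so it is dominated by a multiple of
  the indicator defining \<open>q\<close>. In particular \<open>g\<close> is zero wherever
  \<open>q\<close> is.\<close>

lemma abs_g_le_q:
  assumes "\<And>x. \<bar>wmean x\<bar> \<le> K"
  shows "\<bar>g t\<bar> \<le> K * q t"
proof -
  have "\<bar>g t\<bar> \<le> (LINT \<omega>|M. \<bar>wmean (t + 1 / lam \<omega>)\<bar>)"
    unfolding g_def by (rule integral_abs_bound)
  also have "\<dots> \<le> (LINT \<omega>|M. K * indicator S (t + 1 / lam \<omega>))"
  proof (rule integral_mono)
    show "integrable M (\<lambda>\<omega>. \<bar>wmean (t + 1 / lam \<omega>)\<bar>)"
      using assms by (intro integrable_const_bound[where B = K]) auto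
    show "integrable M (\<lambda>\<omega>. K * indicator S (t + 1 / lam \<omega>))"
      by (intro integrable_mult_right integrable_const_bound[where B = 1]) (auto simp: indicator_def)
    show "\<bar>wmean (t + 1 / lam \<omega>)\<bar> \<le> K * indicator S (t + 1 / lam \<omega>)" for \<omega>
      using assms by (auto simp: indicator_def wmean_off)
  qed
  finally show ?thesis by (simp add: q_def)
qed

text \<open>The product form covers the zeros of \<open>q\<close> as well, where the version
  \<open>us\<close> is arbitrary: there both sides vanish.\<close>

lemma optimal_control_weight:
  assumes "optimal_control M T lmin lmax \<phi> D us" "t \<in> I"
  shows "q t * us t = g t"
proof (cases "q t = 0")
  case True
  obtain K where "\<And>x. \<bar>wmean x\<bar> \<le> K" using wmean_bounded by blast
  from abs_g_le_q[OF this, of t] True show ?thesis by simp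
next
  case False
  then have "0 < q_weight T lmin lmax \<phi> t"
    using q_bounds(1)[of t] by (simp add: q_eq_q_weight)
  then show ?thesis
    using assms False by (auto simp: optimal_control_def q_eq_q_weight g_eq_mean)
qed

lemma q_eq_1:
  assumes "t \<in> I_int T lmin lmax"
  shows "q t = 1"
proof -
  have "q t = (LINT \<omega>|M. 1)"
    unfolding q_def
    by (rule integral_cong_AE) (use shift_in_S[OF assms] in \<open>auto simp: indicator_def\<close>)
  then show ?thesis by (simp add: prob_space)
qed

text \<open>For emission times in \<open>I_int\<close> the shifted times stay in \<open>S\<close>
  almost surely, so the cutoff in \<open>wmean\<close> is invisible and the Lipschitz constant of
  the mean survives averaging over the delay.\<close>

lemma g_lipschitz: "\<exists>L. L-lipschitz_on (I_int T lmin lmax) g"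
proof -
  obtain L where L: "L-lipschitz_on {0..T} (mean_fun M D)" using mean_lipschitz by blast
  obtain K where K: "\<And>x. \<bar>wmean x\<bar> \<le> K" using wmean_bounded by blast
  have int: "integrable M (\<lambda>\<omega>. wmean (t + 1 / lam \<omega>))" for t
    using K by (intro integrable_const_bound[where B = K]) auto
  have "L-lipschitz_on (I_int T lmin lmax) g"
  proof (rule lipschitz_onI)
    fix x y assume xy: "x \<in> I_int T lmin lmax" "y \<in> I_int T lmin lmax"
    have "\<bar>g x - g y\<bar> = \<bar>LINT \<omega>|M. wmean (x + 1 / lam \<omega>) - wmean (y + 1 / lam \<omega>)\<bar>"
      unfolding g_def using int by simp
    also have "\<dots> \<le> (LINT \<omega>|M. \<bar>wmean (x + 1 / lam \<omega>) - wmean (y + 1 / lam \<omega>)\<bar>)"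
      by (rule integral_abs_bound)
    also have "\<dots> \<le> (LINT \<omega>|M. L * \<bar>x - y\<bar>)"
    proof (rule integral_mono_AE)
      show "AE \<omega> in M. \<bar>wmean (x + 1 / lam \<omega>) - wmean (y + 1 / lam \<omega>)\<bar> \<le> L * \<bar>x - y\<bar>"
        using shift_in_S[OF xy(1)] shift_in_S[OF xy(2)]
      proof eventually_elim
        case (elim \<omega>)
        then have "x + 1 / lam \<omega> \<in> {0..T}" "y + 1 / lam \<omega> \<in> {0..T}" using S_subset by blast+
        from lipschitz_onD[OF L this] elim show ?case
          by (simp add: wmean_def zero_ext_def dist_real_def)
      qed
    qed (use int in auto)
    finally show "dist (g x) (g y) \<le> L * dist x y" by (simp add: dist_real_def prob_space)
  qed (rule lipschitz_on_nonneg[OF L])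
  then show ?thesis by blast
qed

section \<open>Admissible controls and the optimality gap\<close>

lemma admissible_lipschitz:
  assumes "L-lipschitz_on {a..b} f"
  shows "admissible {a..b} f"
proof -
  have c: "continuous_on {a..b} f" using assms by (rule lipschitz_on_continuous_on)
  then have "bounded (f ` {a..b})"
    by (intro compact_imp_bounded compact_continuous_image) auto
  then have "\<exists>B. \<forall>x\<in>{a..b}. \<bar>f x\<bar> \<le> B" by (auto simp: bounded_iff)
  moreover have "(\<lambda>x. indicator {a..b} x *\<^sub>R f x) \<in> borel_measurable borel"
    using c by (intro borel_measurable_continuous_on_indicator) auto
  ultimately show ?thesis by (simp add: admissible_def)
qed

lemma admissible_piecewise_const:
  assumes p: "ctrl_partition T lmax n t" and u: "piecewise_const n t u"
  shows "admissible I u"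
proof -
  let ?e = "T - 1 / lmax"
  have t: "t 0 = 0" "t (n + 1) = ?e"
    using p by (auto simp: ctrl_partition_def)
  have "(\<lambda>x. indicator {t 0..<t (n + 1)} x * u x) \<in> borel_measurable borel
      \<and> (\<exists>B. \<forall>x\<in>{t 0..<t (n + 1)}. \<bar>u x\<bar> \<le> B) \<and> t 0 \<le> t (n + 1)"
    by (rule piecewise_const_prefix[OF u p order_refl])
  then obtain B where B: "(\<lambda>x. indicator {0..<?e} x * u x) \<in> borel_measurable borel"
      "\<forall>x\<in>{0..<?e}. \<bar>u x\<bar> \<le> B" "0 \<le> ?e"
    unfolding t(1,2) by blast
  note B(1)[measurable]
  \<comment> \<open>The last grid point belongs to \<open>I\<close> but to no half-open cell; its
    unconstrained value is treated as a separate term.\<close>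
  have "(\<lambda>x. indicator I x * u x) = (\<lambda>x. indicator {0..<?e} x * u x + indicator {?e} x * u ?e)"
    using B(3) by (auto simp: fun_eq_iff indicator_def I_ctrl_def)
  moreover have "(\<lambda>x. indicator {0..<?e} x * u x + indicator {?e} x * u ?e) \<in> borel_measurable borel"
    by measurable
  moreover have "\<forall>x\<in>I. \<bar>u x\<bar> \<le> max B \<bar>u ?e\<bar>"
    using B(2) unfolding I_ctrl_def
    by (metis atLeastAtMost_iff atLeastLessThan_iff le_max_iff_disj order_le_less order_refl)
  ultimately show ?thesis by (auto simp: admissible_def)
qed

lemma admissible_subset:
  assumes u: "admissible A u" and B[measurable]: "B \<in> sets borel" and "B \<subseteq> A"
  shows "admissible B u"
proof -
  have [measurable]: "(\<lambda>x. indicator A x * u x) \<in> borel_measurable borel"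
    using u by (simp add: admissible_def)
  have "(\<lambda>x. indicator B x * u x) = (\<lambda>x. indicator B x * (indicator A x * u x))"
    using assms(3) by (auto simp: fun_eq_iff indicator_def)
  moreover have "(\<lambda>x. indicator B x * (indicator A x * u x)) \<in> borel_measurable borel"
    by measurable
  ultimately show ?thesis using u assms(3) by (auto simp: admissible_def)
qed

text \<open>Completing the square: with \<open>g\<close> replaced by \<open>q * us\<close>, the
  density for \<open>w\<close> minus that for \<open>us\<close> is \<open>q\<close> times the
  squared difference, and the \<open>demand_energy\<close> terms cancel.\<close>

lemma objective_gap:
  assumes w: "admissible A w" and us: "admissible A us" and A: "A \<in> sets borel"
    and opt: "\<And>x. x \<in> A \<Longrightarrow> q x * us x = g x"
  shows "integrable lborel (\<lambda>t. indicator A t * (q t * (w t - us t)\<^sup>2))"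
    and "objective A w - objective A us = (LINT t|lborel. indicator A t * (q t * (w t - us t)\<^sup>2))"
proof -
  have eq: "indicator A t * (q t * (w t - us t)\<^sup>2)
      = indicator A t * (q t * (w t)\<^sup>2 - 2 * g t * w t) - indicator A t * (q t * (us t)\<^sup>2 - 2 * g t * us t)" for t
  proof (cases "t \<in> A")
    case True
    show ?thesis unfolding opt[OF True, symmetric] by (simp add: power2_eq_square algebra_simps)
  qed simp
  note i = loss_density_integrable[OF w A] loss_density_integrable[OF us A]
  show "integrable lborel (\<lambda>t. indicator A t * (q t * (w t - us t)\<^sup>2))"
    unfolding eq using i by simp
  show "objective A w - objective A us = (LINT t|lborel. indicator A t * (q t * (w t - us t)\<^sup>2))"
    unfolding eq objective_eq[OF w A] objective_eq[OF us A] using i by simp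
qed

text \<open>Minimality of \<open>u\<close> concerns all of \<open>I\<close>, the bound only
  \<open>{a..b}\<close>. A competitor \<open>y\<close> equal to \<open>u\<close> outside this
  interval localizes the comparison, and its own gap is controlled by the interpolation
  error.\<close>

lemma optimal_pc_control_gap:
  assumes p: "ctrl_partition T lmax n t" and u: "optimal_pc_control M T lmin lmax lam D n t u"
    and ab: "a \<in> t ` {..n + 1}" "b \<in> t ` {..n + 1}" "a \<le> b" "{a..b} \<subseteq> I"
    and lip: "L-lipschitz_on {a..b} us" and opt: "\<And>x. x \<in> {a..b} \<Longrightarrow> q x * us x = g x"
  shows "\<bar>objective {a..b} u - objective {a..b} us\<bar> \<le> L\<^sup>2 * (b - a) * (mesh n t)\<^sup>2"
proof -
  let ?A = "{a..b}"
  have pcu: "piecewise_const n t u"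
    and min: "\<And>y. piecewise_const n t y \<Longrightarrow> H_full M T lmin lmax lam D u \<le> H_full M T lmin lmax lam D y"
    using u by (auto simp: optimal_pc_control_def is_arg_min_def not_less)
  obtain y where y: "piecewise_const n t y" "\<And>x. x \<notin> {a..<b} \<Longrightarrow> y x = u x"
      "\<And>x. x \<in> {a..<b} \<Longrightarrow> \<bar>y x - us x\<bar> \<le> L * mesh n t"
    using piecewise_const_interpolant[OF p pcu ab(1,2) lip] by blast
  have aI: "admissible I u" "admissible I y"
    using admissible_piecewise_const[OF p] pcu y(1) by auto
  have aA: "admissible ?A u" "admissible ?A y" "admissible ?A us"
    using aI admissible_subset ab(4) admissible_lipschitz[OF lip] by auto
  have A: "?A \<in> sets borel" by simp
  note gap = objective_gap[OF _ aA(3) A opt]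
  have "0 \<le> objective I y - objective I u"
    using min[OF y(1)] aI by (simp add: H_full_eq_objective)
  also have "\<dots> = (LINT t|lborel. indicator I t * (q t * (y t)\<^sup>2 - 2 * g t * y t)
      - indicator I t * (q t * (u t)\<^sup>2 - 2 * g t * u t))"
    using loss_density_integrable[OF aI(1) I_measurable] loss_density_integrable[OF aI(2) I_measurable]
    by (simp add: objective_eq aI)
  \<comment> \<open>Off \<open>{a..b}\<close> the controls \<open>y\<close> and \<open>u\<close>
    agree, so their contributions cancel there.\<close>
  also have "\<dots> = (LINT t|lborel. indicator ?A t * (q t * (y t)\<^sup>2 - 2 * g t * y t)
      - indicator ?A t * (q t * (u t)\<^sup>2 - 2 * g t * u t))"
  proof (intro Bochner_Integration.integral_cong refl)
    fix x
    show "indicator I x * (q x * (y x)\<^sup>2 - 2 * g x * y x) - indicator I x * (q x * (u x)\<^sup>2 - 2 * g x * u x)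
      = indicator ?A x * (q x * (y x)\<^sup>2 - 2 * g x * y x) - indicator ?A x * (q x * (u x)\<^sup>2 - 2 * g x * u x)"
    proof (cases "x \<in> ?A")
      case False
      then have "y x = u x" by (intro y(2)) auto
      then show ?thesis using False by simp
    next
      case True
      then show ?thesis using ab(4) by (auto simp: subset_eq)
    qed
  qed
  also have "\<dots> = objective ?A y - objective ?A u"
    using loss_density_integrable[OF aA(1) A] loss_density_integrable[OF aA(2) A]
    by (simp add: objective_eq aA)
  finally have le: "objective ?A u - objective ?A us \<le> objective ?A y - objective ?A us" by simp
  have "objective ?A y - objective ?A us = (LINT t|lborel. indicator ?A t * (q t * (y t - us t)\<^sup>2))"
    by (rule gap(2)[OF aA(2)])
  \<comment> \<open>Uses \<open>q \<le> 1\<close> and the interpolation bound; the point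
    \<open>b\<close>, where \<open>y\<close> still equals \<open>u\<close>, is discarded as a null
    set.\<close>
  also have "\<dots> \<le> (LINT x|lborel. indicator ?A x * (L * mesh n t)\<^sup>2)"
  proof (rule integral_mono_AE[OF gap(1)[OF aA(2)]])
    show "integrable lborel (\<lambda>x. indicator ?A x * (L * mesh n t)\<^sup>2)"
      by (intro integrable_mult_left integrable_real_indicator) (auto simp: emeasure_lborel_Icc_eq)
    show "AE x in lborel. indicator ?A x * (q x * (y x - us x)\<^sup>2) \<le> indicator ?A x * (L * mesh n t)\<^sup>2"
      using AE_lborel_singleton[of b]
    proof eventually_elim
      case (elim x)
      show ?case
      proof (cases "x \<in> ?A")
        case True
        then have "\<bar>y x - us x\<bar> \<le> L * mesh n t" using elim by (intro y(3)) auto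
        then have "(y x - us x)\<^sup>2 \<le> (L * mesh n t)\<^sup>2"
          using power_mono[of "\<bar>y x - us x\<bar>" "L * mesh n t" 2] by simp
        moreover have "q x * (y x - us x)\<^sup>2 \<le> (y x - us x)\<^sup>2"
          by (rule mult_left_le_one_le) (auto simp: q_bounds)
        ultimately show ?thesis using True by simp
      qed simp
    qed
  qed
  also have "\<dots> = L\<^sup>2 * (b - a) * (mesh n t)\<^sup>2"
    using ab(3) by (simp add: power_mult_distrib)
  finally have "objective ?A u - objective ?A us \<le> L\<^sup>2 * (b - a) * (mesh n t)\<^sup>2" using le by simp
  \<comment> \<open>Nonnegativity of the gap turns the one-sided estimate into one for the absolute
    value.\<close>
  moreover have "0 \<le> (LINT t|lborel. indicator ?A t * (q t * (u t - us t)\<^sup>2))"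
    by (rule integral_nonneg_AE) (simp add: q_bounds)
  then have "0 \<le> objective ?A u - objective ?A us"
    by (simp only: gap(2)[OF aA(1)])
  ultimately show ?thesis by simp
qed

end

section \<open>Second-order convergence of the objectives\<close>

theorem lemma4p6:
  fixes M :: "'a measure"
    and T lmin lmax a b :: real
    and lam :: "'a \<Rightarrow> real" and \<phi> :: "real \<Rightarrow> real" and D :: "real \<Rightarrow> 'a \<Rightarrow> real"
    and ustar :: "real \<Rightarrow> real"
    and grid :: "nat \<Rightarrow> nat \<Rightarrow> real"
    and u :: "nat \<Rightarrow> real \<Rightarrow> real"
  assumes "prob_space M" and "0 < lmin" and "lmin < lmax" and "0 < T"
    and A1: "lam \<in> borel_measurable M" "AE \<omega> in M. lmin \<le> lam \<omega> \<and> lam \<omega> \<le> lmax"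
    and A2: "C1_on {lmin..lmax} (cdf (distr M borel lam))"
            "\<And>x. 0 \<le> \<phi> x" "distributed M lborel lam (\<lambda>x. ennreal (\<phi> x))"
    and A3: "\<And>t \<omega>. t \<in> {0..T} \<Longrightarrow> \<omega> \<in> space M \<Longrightarrow> 0 \<le> D t \<omega>"
            "(\<lambda>(t, \<omega>). D t \<omega>) \<in> borel_measurable (restrict_space borel {0..T} \<Otimes>\<^sub>M M)"
            "integrable (restrict_space lborel {0<..<T} \<Otimes>\<^sub>M M) (\<lambda>(t, \<omega>). (D t \<omega>)\<^sup>2)"
    and A5: "prob_space.indep_set M (sets (vimage_algebra (space M) lam borel))
               (process_events M T D)"
    and "I_int T lmin lmax \<noteq> {}"
    and "a \<le> b" and "compactly_contained {a..b} (I_int T lmin lmax)"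
    and "\<exists>L. L-lipschitz_on {0..T} (mean_fun M D)"
    and "optimal_control M T lmin lmax \<phi> D ustar"
    and "\<And>n. ctrl_partition T lmax n (grid n)"
    and "\<forall>\<^sub>F n in sequentially. a \<in> grid n ` {..n + 1} \<and> b \<in> grid n ` {..n + 1}"
    and "(\<lambda>n. mesh n (grid n)) \<longlonglongrightarrow> 0"
    and "\<And>n. optimal_pc_control M T lmin lmax lam D n (grid n) (u n)"
  shows "(\<lambda>n. H_on M T lam D {a..b} (u n) - H_on M T lam D {a..b} ustar)
           \<in> O(\<lambda>n. (mesh n (grid n))\<^sup>2)
       \<and> ((\<exists>L. L-lipschitz_on (I_ctrl T lmax) ustar) \<longrightarrow>
           (\<lambda>n. H_full M T lmin lmax lam D (u n) - H_full M T lmin lmax lam D ustar)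
             \<in> O(\<lambda>n. (mesh n (grid n))\<^sup>2))"
proof -
  \<comment> \<open>The left-hand side is positive, so a nonempty \<open>I_int\<close> forces
    \<open>1 / lmin \<le> T\<close>, the \<open>horizon\<close> condition.\<close>
  have "1 / lmin - 1 / lmax \<le> T - 1 / lmin"
    using \<open>I_int T lmin lmax \<noteq> {}\<close> by (simp add: I_int_def)
  moreover have "1 / lmax < 1 / lmin"
    using \<open>0 < lmin\<close> \<open>lmin < lmax\<close> by (auto intro!: divide_strict_left_mono)
  ultimately have "1 / lmin \<le> T" by linarith
  interpret prob_space M by fact
  interpret delayed_control M T lmin lmax lam \<phi> D
    by unfold_locales (fact assms \<open>1 / lmin \<le> T\<close>)+
  let ?h = "\<lambda>n. mesh n (grid n)"
  note part = \<open>\<And>n. ctrl_partition T lmax n (grid n)\<close>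
    and opt = \<open>\<And>n. optimal_pc_control M T lmin lmax lam D n (grid n) (u n)\<close>
    and weight = optimal_control_weight[OF \<open>optimal_control M T lmin lmax \<phi> D ustar\<close>]
  have u_adm: "admissible I (u n)" for n
    using opt[of n] by (intro admissible_piecewise_const[OF part[of n]])
      (simp add: optimal_pc_control_def is_arg_min_def)
  have J: "{a..b} \<subseteq> I_int T lmin lmax"
    using \<open>compactly_contained {a..b} (I_int T lmin lmax)\<close> interior_subset
    by (auto simp: compactly_contained_def)
  have "I_int T lmin lmax \<subseteq> I"
    using recip_lmax by (auto simp: I_int_def I_ctrl_def)
  then have JI: "{a..b} \<subseteq> I" using J by blast
  \<comment> \<open>Here \<open>q\<close> is 1, so every version of the optimal control equals
    \<open>g\<close> and inherits its Lipschitz bound.\<close>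
  have ustar_J: "ustar x = g x" if "x \<in> {a..b}" for x
  proof -
    have "x \<in> I" "x \<in> I_int T lmin lmax" using that J JI by blast+
    then show ?thesis using weight[of x] q_eq_1[of x] by simp
  qed
  obtain L where "L-lipschitz_on (I_int T lmin lmax) g" using g_lipschitz by blast
  then have "L-lipschitz_on {a..b} g" using J by (rule lipschitz_on_subset)
  then have lip: "L-lipschitz_on {a..b} ustar"
    by (rule lipschitz_on_transform) (simp add: ustar_J)
  \<comment> \<open>The constant is independent of \<open>n\<close>; the bound holds eventually
    because the grids resolve \<open>a\<close> and \<open>b\<close> eventually.\<close>
  have "\<forall>\<^sub>F n in sequentially. norm (H_on M T lam D {a..b} (u n) - H_on M T lam D {a..b} ustar)
      \<le> L\<^sup>2 * (b - a) * norm ((?h n)\<^sup>2)"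
    using \<open>\<forall>\<^sub>F n in sequentially. a \<in> grid n ` {..n + 1} \<and> b \<in> grid n ` {..n + 1}\<close>
  proof eventually_elim
    case (elim n)
    have "\<bar>objective {a..b} (u n) - objective {a..b} ustar\<bar> \<le> L\<^sup>2 * (b - a) * (?h n)\<^sup>2"
      using elim weight JI
      by (intro optimal_pc_control_gap[OF part opt _ _ \<open>a \<le> b\<close> JI lip]) auto
    moreover have "admissible {a..b} (u n)"
      by (rule admissible_subset[OF u_adm _ JI]) simp
    ultimately show ?case
      by (simp add: H_on_eq_objective J admissible_lipschitz[OF lip])
  qed
  then have "(\<lambda>n. H_on M T lam D {a..b} (u n) - H_on M T lam D {a..b} ustar) \<in> O(\<lambda>n. (?h n)\<^sup>2)"
    by (rule bigoI)
  moreover have "(\<lambda>n. H_full M T lmin lmax lam D (u n) - H_full M T lmin lmax lam D ustar)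
      \<in> O(\<lambda>n. (?h n)\<^sup>2)" if lip_I: "\<exists>L. L-lipschitz_on I ustar"
  proof -
    obtain L where L: "L-lipschitz_on {0..T - 1 / lmax} ustar"
      using lip_I by (auto simp: I_ctrl_def)
    have le: "0 \<le> T - 1 / lmax" using horizon recip_lmax by linarith
    have "\<bar>H_full M T lmin lmax lam D (u n) - H_full M T lmin lmax lam D ustar\<bar>
        \<le> L\<^sup>2 * (T - 1 / lmax - 0) * (?h n)\<^sup>2" for n
    proof -
      \<comment> \<open>Every partition resolves the endpoints of \<open>I\<close> itself, so the
        same gap bound applies on all of \<open>I\<close>, for every \<open>n\<close>, with the
        assumed global Lipschitz constant.\<close>
      have ends: "0 \<in> grid n ` {..n + 1}" "T - 1 / lmax \<in> grid n ` {..n + 1}"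
        using part[of n] by (auto simp: ctrl_partition_def intro: image_eqI[of _ _ 0] image_eqI[of _ _ "n + 1"])
      have "\<bar>objective {0..T - 1 / lmax} (u n) - objective {0..T - 1 / lmax} ustar\<bar>
          \<le> L\<^sup>2 * (T - 1 / lmax - 0) * (?h n)\<^sup>2"
        by (rule optimal_pc_control_gap[OF part opt ends le _ L])
           (use weight in \<open>auto simp: I_ctrl_def\<close>)
      moreover have "admissible I ustar"
        using admissible_lipschitz[OF L] by (simp add: I_ctrl_def)
      ultimately show ?thesis
        using u_adm by (simp add: H_full_eq_objective) (simp add: I_ctrl_def)
    qed
    then show ?thesis by (intro bigoI[where c = "L\<^sup>2 * (T - 1 / lmax - 0)"] always_eventually) simp
  qed
  ultimately show ?thesis by blast
qed

end
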